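(* Let $G$ be a cubic graph and let $F$ be a $1$-factor (perfect matching) of $G$. Then there is a maximum $3$-edge-colorable subgraph $H$ of $G$ with $F\subseteq E(H)$.
   Context: All graphs are finite and undirected, without loops; multiple edges are allowed. A cubic graph is a $3$-regular graph. For a graph $G$ and a positive integer $k$, let $\nu_k(G)$ be the maximum of $|H_1|+\dots+|H_k|$ over all $k$-tuples $(H_1,\dots,H_k)$ of pairwise edge-disjoint matchings of $G$. A subgraph $H$ of $G$ is called maximum $k$-edge-colorable if it is $k$-edge-colorable (properly) and has exactly $\nu_k(G)$ edges. *)

theory Defs
  imports Main
begin

(* A multigraph is a set of vertices and a set of abstract edges, each edge being mapped to
   the set of its end vertices.  Parallel edges are distinct edges with the same ends; loops
   are excluded by requiring two distinct ends. *)
record ('v, 'e) mgraph =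
  verts :: "'v set"
  edges :: "'e set"
  ends :: "'e \<Rightarrow> 'v set"

locale multigraph =
  fixes G :: "('v, 'e) mgraph"
  assumes finite_verts: "finite (verts G)"
    and finite_edges: "finite (edges G)"
    and ends_subset: "e \<in> edges G \<Longrightarrow> ends G e \<subseteq> verts G"
    and card_ends: "e \<in> edges G \<Longrightarrow> card (ends G e) = 2"

(* No edge needs to be counted twice, since there are no loops. *)
definition degree :: "('v, 'e) mgraph \<Rightarrow> 'v \<Rightarrow> nat" where
  "degree G v = card {e \<in> edges G. v \<in> ends G e}"

definition cubic_graph :: "('v, 'e) mgraph \<Rightarrow> bool" where
  "cubic_graph G \<longleftrightarrow> multigraph G \<and> (\<forall>v\<in>verts G. degree G v = 3)"

definition matching :: "('v, 'e) mgraph \<Rightarrow> 'e set \<Rightarrow> bool" where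
  "matching G M \<longleftrightarrow> M \<subseteq> edges G \<and>
     (\<forall>e\<in>M. \<forall>f\<in>M. e \<noteq> f \<longrightarrow> ends G e \<inter> ends G f = {})"

definition perfect_matching :: "('v, 'e) mgraph \<Rightarrow> 'e set \<Rightarrow> bool" where
  "perfect_matching G F \<longleftrightarrow> matching G F \<and> (\<forall>v\<in>verts G. \<exists>e\<in>F. v \<in> ends G e)"

(* The k-tuple of matchings is indexed by the numbers below k; members may be empty. *)
definition disjoint_matchings :: "('v, 'e) mgraph \<Rightarrow> nat \<Rightarrow> (nat \<Rightarrow> 'e set) \<Rightarrow> bool" where
  "disjoint_matchings G k M \<longleftrightarrow> (\<forall>i<k. matching G (M i)) \<and>
     (\<forall>i<k. \<forall>j<k. i \<noteq> j \<longrightarrow> M i \<inter> M j = {})"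

(* For finite G the set below is nonempty and bounded by the number of edges,
   so Max is meaningful. *)
definition nu :: "nat \<Rightarrow> ('v, 'e) mgraph \<Rightarrow> nat" where
  "nu k G = Max {(\<Sum>i<k. card (M i)) | M. disjoint_matchings G k M}"

definition subgraph :: "('v, 'e) mgraph \<Rightarrow> ('v, 'e) mgraph \<Rightarrow> bool" where
  "subgraph H G \<longleftrightarrow> multigraph H \<and> verts H \<subseteq> verts G \<and> edges H \<subseteq> edges G \<and>
     (\<forall>e\<in>edges H. ends H e = ends G e)"

definition proper_edge_coloring :: "('v, 'e) mgraph \<Rightarrow> nat \<Rightarrow> ('e \<Rightarrow> nat) \<Rightarrow> bool" where
  "proper_edge_coloring G k c \<longleftrightarrow> (\<forall>e\<in>edges G. c e < k) \<and>
     (\<forall>e\<in>edges G. \<forall>f\<in>edges G. e \<noteq> f \<and> ends G e \<inter> ends G f \<noteq> {} \<longrightarrow> c e \<noteq> c f)"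

definition edge_colorable :: "nat \<Rightarrow> ('v, 'e) mgraph \<Rightarrow> bool" where
  "edge_colorable k G \<longleftrightarrow> (\<exists>c. proper_edge_coloring G k c)"

definition maximum_edge_colorable_subgraph ::
    "nat \<Rightarrow> ('v, 'e) mgraph \<Rightarrow> ('v, 'e) mgraph \<Rightarrow> bool" where
  "maximum_edge_colorable_subgraph k H G \<longleftrightarrow>
     subgraph H G \<and> edge_colorable k H \<and> card (edges H) = nu k G"

end

theory Submission
  imports Defs
begin

text \<open>
  Among the optimal triples of disjoint matchings choose one covering as many edges of \<open>F\<close> as
  possible. If an edge \<open>e = uv\<close> of \<open>F\<close> were left uncoloured, at most two colours would occur at
  \<open>v\<close>; colour \<open>e\<close> with a colour \<open>i\<close> missing at \<open>v\<close> and uncolour the edge of colour \<open>i\<close> at \<open>u\<close>,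
  if there is one. That edge meets \<open>e\<close> and so lies outside \<open>F\<close>; the exchange loses no
  coloured edge in total and covers one more edge of \<open>F\<close>. The argument works for any matching
  \<open>F\<close> and any number of colours that is at least the maximum degree.
\<close>

lemma (in multigraph) finite_matching: "matching G M \<Longrightarrow> finite M"
  using finite_edges finite_subset unfolding matching_def by blast

lemma (in multigraph) card_UN_disjoint_matchings:
  assumes "disjoint_matchings G k M"
  shows "card (\<Union>i<k. M i) = (\<Sum>i<k. card (M i))"
  using assms finite_matching unfolding disjoint_matchings_def
  by (intro card_UN_disjoint) auto

lemma (in multigraph) finite_matching_sizes:
  "finite {(\<Sum>i<k. card (M i)) | M. disjoint_matchings G k M}"
proof (rule finite_subset)
  show "{(\<Sum>i<k. card (M i)) | M. disjoint_matchings G k M} \<subseteq> {..card (edges G)}"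
  proof clarsimp
    fix M assume M: "disjoint_matchings G k M"
    then have "(\<Union>i<k. M i) \<subseteq> edges G"
      unfolding disjoint_matchings_def matching_def by blast
    then show "(\<Sum>i<k. card (M i)) \<le> card (edges G)"
      using card_mono[OF finite_edges] card_UN_disjoint_matchings[OF M] by metis
  qed
qed simp

lemma (in multigraph) sum_card_le_nu:
  "disjoint_matchings G k M \<Longrightarrow> (\<Sum>i<k. card (M i)) \<le> nu k G"
  unfolding nu_def by (rule Max_ge[OF finite_matching_sizes]) blast

lemma (in multigraph) nu_attained:
  obtains M where "disjoint_matchings G k M" "(\<Sum>i<k. card (M i)) = nu k G"
proof -
  \<comment> \<open>Empty matchings make the set of sizes nonempty, so its maximum is
    attained.\<close>
  have "disjoint_matchings G k (\<lambda>_. {})"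
    by (simp add: disjoint_matchings_def matching_def)
  then have "{(\<Sum>i<k. card (M i)) | M. disjoint_matchings G k M} \<noteq> {}"
    by blast
  from Max_in[OF finite_matching_sizes this] show ?thesis
    using that unfolding nu_def by auto
qed

text \<open>If all \<open>k\<close> colours occurred at \<open>v\<close>, disjointness would give
  \<open>k\<close> distinct coloured edges there; the uncoloured \<open>e\<close> would be one more,
  exceeding the degree bound.\<close>

lemma (in multigraph) missing_color:
  assumes M: "disjoint_matchings G k M" and deg: "degree G v \<le> k"
    and e: "e \<in> edges G" "v \<in> ends G e" "e \<notin> (\<Union>i<k. M i)"
  obtains i where "i < k" "\<forall>g\<in>M i. v \<notin> ends G g"
proof (rule ccontr)
  assume "\<not> thesis"
  with that have "\<forall>i\<in>{..<k}. \<exists>g. g \<in> M i \<and> v \<in> ends G g" by blast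
  then obtain g where g: "\<And>i. i < k \<Longrightarrow> g i \<in> M i \<and> v \<in> ends G (g i)"
    by (metis lessThan_iff)
  have inj: "inj_on g {..<k}"
    using g M unfolding disjoint_matchings_def by (intro inj_onI) (metis IntI empty_iff lessThan_iff)
  have "g ` {..<k} \<subseteq> {e \<in> edges G. v \<in> ends G e}"
    using g M unfolding disjoint_matchings_def matching_def by fastforce
  moreover have "e \<notin> g ` {..<k}" using g e(3) by force
  ultimately have "g ` {..<k} \<subset> {e \<in> edges G. v \<in> ends G e}" using e(1,2) by blast
  then have "card (g ` {..<k}) < degree G v"
    unfolding degree_def using finite_edges by (intro psubset_card_mono) auto
  then show False using deg inj by (simp add: card_image)
qed

text \<open>The second conclusion keeps an optimal family optimal; the strict inclusion is what
  contradicts a maximal covering of \<open>F\<close>.\<close>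

lemma (in multigraph) exchange_matching_edge:
  assumes M: "disjoint_matchings G k M" and deg: "\<forall>v\<in>verts G. degree G v \<le> k"
    and F: "matching G F" and e: "e \<in> F" "e \<notin> (\<Union>i<k. M i)"
  obtains M' where "disjoint_matchings G k M'"
    "(\<Sum>i<k. card (M i)) \<le> (\<Sum>i<k. card (M' i))"
    "F \<inter> (\<Union>i<k. M i) \<subset> F \<inter> (\<Union>i<k. M' i)"
proof -
  have eG: "e \<in> edges G" using F e unfolding matching_def by blast
  obtain u v where uv: "ends G e = {u, v}"
    using card_ends[OF eG] by (auto simp: card_2_iff)
  have "v \<in> verts G" using ends_subset[OF eG] uv by blast
  then obtain i where i: "i < k" and v: "\<forall>g\<in>M i. v \<notin> ends G g"
    using missing_color[OF M _ eG, of v] deg uv e by auto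
  \<comment> \<open>The edges that block colour \<open>i\<close> for \<open>e\<close>. Taking a set
    instead of a single edge treats the case of no such edge together with that of exactly
    one.\<close>
  define B where "B = {g \<in> M i. u \<in> ends G g}"
  have Mi: "matching G (M i)" using M i by (simp add: disjoint_matchings_def)
  have e_notin: "e \<notin> M i" using e i by blast
  have "\<forall>g\<in>B. \<forall>h\<in>B. g = h"
    using Mi unfolding B_def matching_def by blast
  then have cardB: "card B \<le> 1"
    by (auto simp: card_le_Suc0_iff_eq B_def finite_matching[OF Mi])
  \<comment> \<open>An edge of \<open>B\<close> shares \<open>u\<close> with \<open>e\<close> and
    differs from \<open>e\<close>, which is uncoloured; the matching \<open>F\<close> contains no
    such edge.\<close>
  have BF: "B \<inter> F = {}"
  proof -
    have "ends G g \<inter> ends G e = {}" if "g \<in> F" "g \<noteq> e" for g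
      using F e(1) that unfolding matching_def by blast
    then show ?thesis using e_notin uv unfolding B_def by blast
  qed
  define N where "N = insert e (M i - B)"
  define M' where "M' = M(i := N)"
  have "matching G N"
  proof -
    \<comment> \<open>The remaining edges of colour \<open>i\<close> avoid \<open>v\<close> by the
      choice of \<open>i\<close>, and \<open>u\<close> because \<open>B\<close> is removed.\<close>
    have "ends G g \<inter> ends G e = {}" if "g \<in> M i - B" for g
      using that v uv unfolding B_def by auto
    then show ?thesis using Mi eG unfolding N_def matching_def by (auto simp: Int_commute)
  qed
  have "disjoint_matchings G k M'"
  proof -
    have disj: "M a \<inter> M b = {}" if "a < k" "b < k" "a \<noteq> b" for a b
      using M that unfolding disjoint_matchings_def by blast
    have "N \<inter> M j = {}" if "j < k" "j \<noteq> i" for j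
      using disj[OF i that(1)] that e unfolding N_def by blast
    then have "M' a \<inter> M' b = {}" if "a < k" "b < k" "a \<noteq> b" for a b
      using disj[OF that] that unfolding M'_def by (simp add: Int_commute)
    with \<open>matching G N\<close> show ?thesis
      using M unfolding disjoint_matchings_def by (simp add: M'_def)
  qed
  \<comment> \<open>One edge is gained and at most one is lost.\<close>
  moreover have "card (M i) \<le> card N"
  proof -
    have "finite (M i)" using finite_matching[OF Mi] .
    moreover have "B \<subseteq> M i" unfolding B_def by blast
    ultimately show ?thesis
      using cardB e_notin card_Diff_subset[of B "M i"] finite_subset[of B "M i"]
      unfolding N_def by simp
  qed
  then have "(\<Sum>j<k. card (M j)) \<le> (\<Sum>j<k. card (M' j))"
    unfolding M'_def by (intro sum_mono) auto
  moreover have "F \<inter> (\<Union>j<k. M j) \<subset> F \<inter> (\<Union>j<k. M' j)"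
  proof
    show "F \<inter> (\<Union>j<k. M j) \<subseteq> F \<inter> (\<Union>j<k. M' j)"
    proof clarify
      fix x j assume "x \<in> F" "j < k" "x \<in> M j"
      then have "x \<in> M' j" using BF by (auto simp: M'_def N_def)
      with \<open>j < k\<close> show "x \<in> (\<Union>j<k. M' j)" by blast
    qed
    have "e \<in> M' i" by (simp add: M'_def N_def)
    then show "F \<inter> (\<Union>j<k. M j) \<noteq> F \<inter> (\<Union>j<k. M' j)" using e i by blast
  qed
  ultimately show ?thesis by (rule that)
qed

text \<open>The matchings are the colour classes of a proper colouring of their union; all vertices
  of \<open>G\<close> are kept.\<close>

lemma (in multigraph) maximum_edge_colorable_subgraph_of_matchings:
  assumes M: "disjoint_matchings G k M" and nu: "(\<Sum>i<k. card (M i)) = nu k G"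
  shows "maximum_edge_colorable_subgraph k (G\<lparr>edges := \<Union>i<k. M i\<rparr>) G"
proof -
  let ?H = "G\<lparr>edges := \<Union>i<k. M i\<rparr>"
  have sub: "(\<Union>i<k. M i) \<subseteq> edges G"
    using M unfolding disjoint_matchings_def matching_def by blast
  have "multigraph ?H"
    using sub finite_verts finite_edges ends_subset card_ends
    by unfold_locales (auto intro: finite_subset)
  then have "subgraph ?H G" using sub by (simp add: subgraph_def)
  moreover have "edge_colorable k ?H"
  proof -
    have "\<forall>e\<in>(\<Union>i<k. M i). \<exists>i. i < k \<and> e \<in> M i" by blast
    \<comment> \<open>\<open>c\<close> chooses the index of a matching containing the edge, so edges
      of equal colour lie in a common matching.\<close>
    then obtain c where c: "\<And>e. e \<in> (\<Union>i<k. M i) \<Longrightarrow> c e < k \<and> e \<in> M (c e)"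
      by metis
    have "c e \<noteq> c f" if "e \<in> (\<Union>i<k. M i)" "f \<in> (\<Union>i<k. M i)" "e \<noteq> f"
      "ends G e \<inter> ends G f \<noteq> {}" for e f
      using c[OF that(1)] c[OF that(2)] that(3,4) M
      unfolding disjoint_matchings_def matching_def by metis
    then have "proper_edge_coloring ?H k c"
      using c unfolding proper_edge_coloring_def by simp
    then show ?thesis unfolding edge_colorable_def by blast
  qed
  moreover have "card (edges ?H) = nu k G"
    using card_UN_disjoint_matchings[OF M] nu by simp
  ultimately show ?thesis unfolding maximum_edge_colorable_subgraph_def by blast
qed

lemma (in multigraph) matching_in_maximum_edge_colorable_subgraph:
  assumes deg: "\<forall>v\<in>verts G. degree G v \<le> k" and F: "matching G F"
  shows "\<exists>H. maximum_edge_colorable_subgraph k H G \<and> F \<subseteq> edges H"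
proof -
  define opt where
    "opt M \<longleftrightarrow> disjoint_matchings G k M \<and> (\<Sum>i<k. card (M i)) = nu k G" for M
  define cov where "cov M = card (F \<inter> (\<Union>i<k. M i))" for M :: "nat \<Rightarrow> 'e set"
  have finF: "finite F" using finite_matching[OF F] .
  obtain M0 where "opt M0" using nu_attained unfolding opt_def by metis
  \<comment> \<open>A uniform bound on \<open>cov\<close> guarantees that a greatest value exists
    among the optimal families.\<close>
  moreover have "\<forall>M. opt M \<longrightarrow> cov M < Suc (card F)"
    unfolding cov_def using finF by (simp add: card_mono less_Suc_eq_le)
  ultimately obtain M where M: "opt M" and max: "\<And>M'. opt M' \<Longrightarrow> cov M' \<le> cov M"
    using ex_has_greatest_nat[of opt M0 cov "Suc (card F)"] by blast
  have dM: "disjoint_matchings G k M" using M unfolding opt_def by blast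
  have "F \<subseteq> (\<Union>i<k. M i)"
  proof
    fix e assume "e \<in> F"
    show "e \<in> (\<Union>i<k. M i)"
    proof (rule ccontr)
      assume "e \<notin> (\<Union>i<k. M i)"
      then obtain M' where M': "disjoint_matchings G k M'"
        "(\<Sum>i<k. card (M i)) \<le> (\<Sum>i<k. card (M' i))"
        and less: "F \<inter> (\<Union>i<k. M i) \<subset> F \<inter> (\<Union>i<k. M' i)"
        by (rule exchange_matching_edge[OF dM deg F \<open>e \<in> F\<close>])
      \<comment> \<open>The new total is at least that of \<open>M\<close>, which is
        \<open>nu k G\<close>, and never above \<open>nu k G\<close>.\<close>
      have "opt M'"
        using M M' sum_card_le_nu[OF M'(1)] unfolding opt_def by simp
      moreover have "cov M < cov M'"
        unfolding cov_def using less finF by (intro psubset_card_mono) auto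
      ultimately show False using max by fastforce
    qed
  qed
  then show ?thesis
    using maximum_edge_colorable_subgraph_of_matchings M unfolding opt_def
    by (intro exI[of _ "G\<lparr>edges := \<Union>i<k. M i\<rparr>"]) simp
qed

theorem theorem2:
  fixes G :: "('v, 'e) mgraph" and F :: "'e set"
  assumes "cubic_graph G" and "perfect_matching G F"
  shows "\<exists>H. maximum_edge_colorable_subgraph 3 H G \<and> F \<subseteq> edges H"
proof -
  interpret multigraph G using assms(1) by (simp add: cubic_graph_def)
  show ?thesis
    using assms matching_in_maximum_edge_colorable_subgraph[of 3 F]
    by (simp add: cubic_graph_def perfect_matching_def)
qed

end
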